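(* Let $k\in\mathbb{Z}_+$ and consider a $k$-total reward BW-game on a finite digraph $G=(V,E)$ (every vertex having an outgoing arc, $V=B\cup W$) with local rewards $r:E\to\mathbb{R}$ and a fixed initial position $v_0$. Given a pure stationary strategy of one player, there exists a pure stationary strategy of the opponent that is a best response among all (not necessarily pure or stationary) strategies of the opponent; i.e. if \textsc{Min} fixes a pure stationary $\sigma_B^*$, there is a pure stationary $\sigma_W^*$ with $\phi^{(k)}(\mathbf a(\sigma_B^*,\sigma_W))\le\phi^{(k)}(\mathbf a(\sigma_B^*,\sigma_W^* ))$ for every strategy $\sigma_W$ of \textsc{Max}, and symmetrically (with the inequality reversed) when \textsc{Max} fixes a pure stationary strategy.
   Context: In a BW-game, starting at $v_0$, the player controlling the current position ($B$: \textsc{Min}, $W$: \textsc{Max}) chooses an outgoing arc; a play is an infinite sequence of arcs $e_1,e_2,\dots$. Strategies may be history dependent and randomized; a pure stationary strategy picks one fixed outgoing arc at each of the player's vertices. For a pair of strategies $(\sigma_B,\sigma_W)$, $\mathbf a(\sigma_B,\sigma_W)=(a_1,a_2,\dots)$ denotes the sequence of expected local rewards $a_t=\mathbb{E}[r(e_t)]$. For an infinite real sequence $\mathbf a$, $M(\mathbf a)=(a_1,a_1+a_2,a_1+a_2+a_3,\dots)$, $M^0$ is the identity, $M^k=M\circ M^{k-1}$, $A(\mathbf a)=\liminf_{T\to\infty}\frac1T\sum_{j=1}^T a_j$, and the $k$-total reward is $\phi^{(k)}(\mathbf a)=A(M^k(\mathbf a))\in\mathbb{R}\cup\{\pm\infty\}$;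 \textsc{Min} pays \textsc{Max} the amount $\phi^{(k)}(\mathbf a(\sigma_B,\sigma_W))$. *)

theory Defs
  imports "HOL-Probability.Probability" "Graph_Theory.Arc_Walk"
begin

text \<open>
  Arcs are objects of their own, so parallel arcs and loops are allowed; simple
  digraphs are the instances in which an arc is determined by its end points.
\<close>

locale bw_game = fin_digraph G
  for G :: "('a, 'b) pre_digraph" (structure) +
  fixes B W :: "'a set" and v0 :: 'a
  assumes positions: "verts G = B \<union> W" "B \<inter> W = {}"
    and no_sinks: "v \<in> verts G \<Longrightarrow> out_arcs G v \<noteq> {}"
    and initial: "v0 \<in> verts G"

text \<open>
  A history is the list of arcs traversed so far, starting at \<open>v0\<close>. A (behavioural)
  strategy assigns to every history a distribution on arcs; it matters only at
  histories that are walks from \<open>v0\<close> ending at a position controlled by the player.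
\<close>

type_synonym 'b strategy = "'b list \<Rightarrow> 'b pmf"

definition current :: "('a, 'b) pre_digraph \<Rightarrow> 'a \<Rightarrow> 'b list \<Rightarrow> 'a" where
  "current G v0 h = (if h = [] then v0 else head G (last h))"

definition strategies :: "('a, 'b) pre_digraph \<Rightarrow> 'a set \<Rightarrow> 'a \<Rightarrow> 'b strategy set" where
  "strategies G S v0 = {\<sigma>. \<forall>h v. pre_digraph.awalk G v0 h v \<and> v \<in> S \<longrightarrow>
     set_pmf (\<sigma> h) \<subseteq> out_arcs G v}"

definition pure_stationary :: "('a, 'b) pre_digraph \<Rightarrow> 'a set \<Rightarrow> ('a \<Rightarrow> 'b) set" where
  "pure_stationary G S = {s. \<forall>v\<in>S. s v \<in> out_arcs G v}"

definition stationary_strategy :: "('a, 'b) pre_digraph \<Rightarrow> 'a \<Rightarrow> ('a \<Rightarrow> 'b) \<Rightarrow> 'b strategy" where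
  "stationary_strategy G v0 s = (\<lambda>h. return_pmf (s (current G v0 h)))"

definition next_arc ::
  "('a, 'b) pre_digraph \<Rightarrow> 'a set \<Rightarrow> 'a \<Rightarrow> 'b strategy \<Rightarrow> 'b strategy \<Rightarrow> 'b list \<Rightarrow> 'b pmf" where
  "next_arc G B v0 \<sigma>B \<sigma>W h = (if current G v0 h \<in> B then \<sigma>B h else \<sigma>W h)"

text \<open>The law of the first \<open>n\<close> arcs of the random play.\<close>

primrec history_pmf ::
  "('a, 'b) pre_digraph \<Rightarrow> 'a set \<Rightarrow> 'a \<Rightarrow> 'b strategy \<Rightarrow> 'b strategy \<Rightarrow> nat \<Rightarrow> 'b list pmf" where
  "history_pmf G B v0 \<sigma>B \<sigma>W 0 = return_pmf []"
| "history_pmf G B v0 \<sigma>B \<sigma>W (Suc n) =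
     bind_pmf (history_pmf G B v0 \<sigma>B \<sigma>W n)
       (\<lambda>h. map_pmf (\<lambda>e. h @ [e]) (next_arc G B v0 \<sigma>B \<sigma>W h))"

text \<open>
  Sequences are indexed from 0: the value at \<open>t\<close> is the expected reward of the
  \<open>(t + 1)\<close>-st arc of the play, that is, of the last arc of its first \<open>t + 1\<close> arcs.
\<close>

definition expected_rewards ::
  "('a, 'b) pre_digraph \<Rightarrow> 'a set \<Rightarrow> ('b \<Rightarrow> real) \<Rightarrow> 'a \<Rightarrow> 'b strategy \<Rightarrow> 'b strategy \<Rightarrow> nat \<Rightarrow> real" where
  "expected_rewards G B r v0 \<sigma>B \<sigma>W t =
     measure_pmf.expectation (history_pmf G B v0 \<sigma>B \<sigma>W (Suc t)) (\<lambda>h. r (last h))"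

definition partial_sums :: "(nat \<Rightarrow> real) \<Rightarrow> nat \<Rightarrow> real" where
  "partial_sums a n = (\<Sum>i\<le>n. a i)"

definition lim_avg :: "(nat \<Rightarrow> real) \<Rightarrow> ereal" where
  "lim_avg a = liminf (\<lambda>T. ereal ((\<Sum>i<T. a i) / real T))"

definition total_reward :: "nat \<Rightarrow> (nat \<Rightarrow> real) \<Rightarrow> ereal" where
  "total_reward k a = lim_avg ((partial_sums ^^ k) a)"

definition payoff ::
  "nat \<Rightarrow> ('a, 'b) pre_digraph \<Rightarrow> 'a set \<Rightarrow> ('b \<Rightarrow> real) \<Rightarrow> 'a \<Rightarrow> 'b strategy \<Rightarrow> 'b strategy \<Rightarrow> ereal" where
  "payoff k G B r v0 \<sigma>B \<sigma>W = total_reward k (expected_rewards G B r v0 \<sigma>B \<sigma>W)"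

end

theory Submission
  imports Defs
begin

text \<open>
  Fixing one player leaves a one-player problem on a finite graph. Summing the first \<open>T\<close> terms of
  the \<open>k\<close>-fold partial sums of the expected rewards gives the sum of \<open>c(T - 1 - t) a(t)\<close> over
  \<open>t < T\<close>, where \<open>c(n)\<close> is the binomial coefficient of \<open>n + k\<close> over \<open>k\<close>, so up to a bounded error it
  suffices to maximise this finite-horizon reward for all \<open>T\<close> at once.

  A stationary policy that is discount optimal for all discount factors close to 1 does this. Its
  discounted values are \<open>q(X) / (1 - X ^ N)\<close> with polynomials \<open>q\<close>, and optimality says that
  \<open>q v - X q w - (1 - X ^ N) r(e)\<close> is nonnegative just below 1 for every arc \<open>e\<close> from \<open>v\<close> to \<open>w\<close>, and
  zero if \<open>e\<close> is used by the policy. Let \<open>X\<close> act on real polynomials as the backward shift and solve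
  \<open>(1 - X ^ N) g = c\<close>. Then \<open>F n v = (q v \<cdot> g)(n - 1)\<close> satisfies
  \<open>F (n + 1) v - F n w - c(n) r(e) = ((q v - X q w - (1 - X ^ N) r(e)) \<cdot> g)(n)\<close>, which is nonnegative
  for large \<open>n\<close> because a polynomial nonnegative just below 1 maps polynomials with nonnegative
  leading coefficient to such polynomials. Telescoping bounds the finite-horizon reward of every
  strategy by \<open>F T v0\<close> plus a constant, and the stationary policy attains it up to a constant.
\<close>

section \<open>Shift operators on real polynomials\<close>

lemma poly_eventually_nonneg_iff:
  fixes g :: "real poly"
  shows "0 \<le> lead_coeff g \<longleftrightarrow> (\<forall>\<^sub>F x in at_top. 0 \<le> poly g x)"
proof -
  have nonneg: "\<forall>\<^sub>F x in at_top. 0 < poly h x" if "0 < lead_coeff h" for h :: "real poly"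
  proof -
    obtain n where "\<forall>x\<ge>n. lead_coeff h \<le> poly h x"
      using poly_pinfty_gt_lc \<open>0 < lead_coeff h\<close> by blast
    with that show ?thesis
      unfolding eventually_at_top_linorder by (meson less_le_trans)
  qed
  show ?thesis
  proof
    assume "0 \<le> lead_coeff g"
    then consider "g = 0" | "0 < lead_coeff g"
      by (metis leading_coeff_0_iff order_less_le)
    then show "\<forall>\<^sub>F x in at_top. 0 \<le> poly g x"
      by cases (use nonneg[of g] in \<open>auto elim: eventually_mono\<close>)
  next
    assume ev: "\<forall>\<^sub>F x in at_top. 0 \<le> poly g x"
    show "0 \<le> lead_coeff g"
    proof (rule ccontr)
      assume "\<not> 0 \<le> lead_coeff g"
      then have "\<forall>\<^sub>F x in at_top. 0 < poly (- g) x"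
        by (intro nonneg) simp
      with ev have "\<forall>\<^sub>F x in (at_top :: real filter). False"
        by eventually_elim simp
      then show False by simp
    qed
  qed
qed

text \<open>By the mean value theorem \<open>g(x) - g(x - h)\<close> is \<open>h\<close> times a
  value of the derivative, whose leading coefficient is again nonnegative; so it is nonnegative for
  large \<open>x\<close>.\<close>

lemma lead_coeff_backward_difference_nonneg:
  fixes g :: "real poly"
  assumes "0 \<le> lead_coeff g" "0 < h"
  shows "0 \<le> lead_coeff (g - pcompose g [:-h, 1:])"
proof -
  have "0 \<le> lead_coeff (pderiv g)"
    using assms(1) by (cases "degree g") (simp_all add: degree_pderiv coeff_pderiv coeff_eq_0)
  then obtain n where n: "\<And>x. n \<le> x \<Longrightarrow> 0 \<le> poly (pderiv g) x"
    unfolding poly_eventually_nonneg_iff eventually_at_top_linorder by blast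
  have "0 \<le> poly (g - pcompose g [:-h, 1:]) x" if "n + h \<le> x" for x
  proof -
    obtain z where "x - h < z" "poly g x - poly g (x - h) = (x - (x - h)) * poly (pderiv g) z"
      using poly_MVT[of "x - h" x g] assms(2) by auto
    then show ?thesis
      using n[of z] that assms(2) by (simp add: poly_pcompose)
  qed
  then show ?thesis
    unfolding poly_eventually_nonneg_iff eventually_at_top_linorder by blast
qed

text \<open>The difference of a monomial of degree \<open>d + 1\<close> has degree \<open>d\<close>,
  so a suitable multiple of it removes the top coefficient of \<open>c\<close>; induction on the
  degree does the rest.\<close>

lemma backward_difference_eq_solvable:
  fixes c :: "real poly"
  assumes "h \<noteq> 0"
  shows "\<exists>g. g - pcompose g [:-h, 1:] = c"
proof -
  \<comment> \<open>The zero polynomial has degree 0 too; listing it separately makes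
    \<open>d = 0\<close> the trivial case.\<close>
  have "\<exists>g. g - pcompose g [:-h, 1:] = c" if "degree c < d \<or> c = 0" for c and d
    using that
  proof (induction d arbitrary: c)
    case 0
    then have "0 - pcompose 0 [:-h, 1:] = c" by simp
    then show ?case by blast
  next
    case (Suc d)
    \<comment> \<open>The coefficient of \<open>x ^ d\<close> in
      \<open>x ^ (d + 1) - (x - h) ^ (d + 1)\<close> is \<open>h * (d + 1)\<close>, hence the
      denominator.\<close>
    define m where "m = monom (coeff c d / (h * real (Suc d))) (Suc d)"
    define b where "b = m - pcompose m [:-h, 1:]"
    have m_comp: "pcompose m [:-h, 1:] = smult (coeff c d / (h * real (Suc d))) ([:-h, 1:] ^ Suc d)"
    proof -
      have "pcompose ([:0, 1:] ^ n) [:-h, 1:] = [:-h, 1:] ^ n" for n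
        by (induction n) (simp_all add: pcompose_1 pcompose_mult pcompose_pCons)
      then show ?thesis
        unfolding m_def monom_altdef pcompose_smult by (simp del: power_Suc)
    qed
    have b_coeff: "coeff b i = (if i = Suc d then coeff c d / (h * real (Suc d)) else 0)
        - coeff c d / (h * real (Suc d)) * (real (Suc d choose i) * (-h) ^ (Suc d - i))"
      if "i \<le> Suc d" for i
      using that by (simp add: b_def m_comp coeff_linear_poly_power del: power_Suc) (simp add: m_def)
    have "degree b \<le> Suc d"
      unfolding b_def m_def by (intro degree_diff_le) (simp_all add: degree_monom_le degree_pcompose)
    moreover have "coeff b (Suc d) = 0"
      by (simp add: b_coeff)
    ultimately have "degree b \<le> d"
      by (metis coeff_0_degree_minus_1 degree_0 diff_Suc_1 le_Suc_eq le0)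
    moreover have "coeff b d = coeff c d"
      using assms by (simp add: b_coeff del: of_nat_Suc)
    moreover have "degree c \<le> d"
      using Suc.prems by auto
    ultimately have "degree (c - b) \<le> d" "coeff (c - b) d = 0"
      by (auto intro: degree_diff_le)
    then have "degree (c - b) < d \<or> c - b = 0"
      by (metis leading_coeff_0_iff le_neq_implies_less)
    then obtain g where "g - pcompose g [:-h, 1:] = c - b"
      using Suc.IH by blast
    then have "(g - pcompose g [:-h, 1:]) + b = c" by simp
    moreover have "(g + m) - pcompose (g + m) [:-h, 1:] = (g - pcompose g [:-h, 1:]) + b"
      by (simp add: b_def pcompose_add)
    ultimately have "(g + m) - pcompose (g + m) [:-h, 1:] = c" by simp
    then show ?case by blast
  qed
  from this[of c "Suc (degree c)"] show ?thesis by simp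
qed

text \<open>The indeterminate of \<open>p\<close> acts on \<open>g\<close> as the backward shift \<open>g(x) \<mapsto> g(x - 1)\<close>.\<close>

definition shift_act :: "real poly \<Rightarrow> real poly \<Rightarrow> real poly" where
  "shift_act p g = fold_coeffs (\<lambda>a h. smult a g + pcompose h [:-1, 1:]) p 0"

lemma shift_act_0 [simp]: "shift_act 0 g = 0"
  by (simp add: shift_act_def)

lemma shift_act_pCons [simp]:
  "shift_act (pCons a p) g = smult a g + pcompose (shift_act p g) [:-1, 1:]"
  by (cases "a = 0 \<and> p = 0") (auto simp: shift_act_def)

lemma shift_act_0_right [simp]: "shift_act p 0 = 0"
  by (induction p) auto

lemma shift_act_add: "shift_act (p + q) g = shift_act p g + shift_act q g"
  by (induction p q rule: poly_induct2) (auto simp: smult_add_left pcompose_add)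

lemma shift_act_smult: "shift_act (smult a p) g = smult a (shift_act p g)"
  by (induction p) (auto simp: smult_add_right pcompose_smult)

lemma shift_act_diff: "shift_act (p - q) g = shift_act p g - shift_act q g"
  using shift_act_add[of "p - q" q g] by simp

lemma shift_act_mult: "shift_act (p * q) g = shift_act p (shift_act q g)"
  by (induction p) (auto simp: shift_act_add shift_act_smult)

lemma shift_act_monom: "shift_act (monom 1 n) g = pcompose g [:- real n, 1:]"
proof (induction n)
  case (Suc n)
  have "pcompose (pcompose g [:- real n, 1:]) [:-1, 1:] = pcompose g [:- real (Suc n), 1:]"
    by (simp add: pcompose_assoc[symmetric] pcompose_pCons algebra_simps)
  with Suc show ?case by (simp add: monom_Suc)
qed (simp add: one_pCons)

text \<open>A shift preserves degree and leading coefficient, so at the top degree the indeterminate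
  acts as 1 and \<open>p\<close> as the scalar \<open>p(1)\<close>. A bound \<open>n\<close>
  replaces the degree because \<open>p(1) = 0\<close> makes the degree drop.\<close>

lemma coeff_shift_act:
  assumes "degree g \<le> n"
  shows "degree (shift_act p g) \<le> n \<and> coeff (shift_act p g) n = poly p 1 * coeff g n"
proof (induction p)
  case (pCons a p)
  have "coeff (pcompose h [:-1, 1:]) n = coeff h n" if "degree h \<le> n" for h :: "real poly"
  proof (cases "degree h = n")
    case True
    then show ?thesis
      using lead_coeff_comp[of "[:-1, 1:]" h] by (simp add: degree_pcompose)
  next
    case False
    with that have "degree h < n" by simp
    then show ?thesis
      by (simp add: coeff_eq_0 degree_pcompose)
  qed
  with pCons assms show ?case
    by (auto intro!: degree_add_le simp: degree_pcompose algebra_simps intro: order.trans[OF degree_smult_le])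
qed auto

text \<open>
  Equivalent to being nonnegative on some interval \<open>(b, 1)\<close>; the factored form is what the
  shift action can use, since \<open>1 - X\<close> acts as the backward difference.
\<close>

definition nonneg_left_1 :: "real poly \<Rightarrow> bool" where
  "nonneg_left_1 p \<longleftrightarrow> p = 0 \<or> (\<exists>m q. p = [:1, -1:] ^ m * q \<and> 0 < poly q 1)"

text \<open>Split off the zero at 1 with its full multiplicity; the sign of the cofactor at 1 then
  decides the sign of \<open>p\<close> just below 1.\<close>

lemma nonneg_left_1_or_neg:
  "nonneg_left_1 p \<or> (\<forall>\<^sub>F x in at_left 1. poly p x < 0)"
proof (cases "p = 0")
  case False
  define m where "m = order 1 p"
  from order_decomp[OF False, of 1] obtain q where q: "p = [:-1, 1:] ^ m * q" "\<not> [:-1, 1:] dvd q"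
    unfolding m_def by auto
  \<comment> \<open>The sign turns powers of \<open>X - 1\<close> into powers of
    \<open>1 - X\<close>, which are positive below 1.\<close>
  define q' where "q' = smult ((-1) ^ m) q"
  have "[:-1, 1:] ^ m = smult ((-1) ^ m) ([:1, -1:] ^ m :: real poly)"
    by (subst smult_power[symmetric]) simp
  with q(1) have p: "p = [:1, -1:] ^ m * q'"
    by (simp add: q'_def)
  have "poly q 1 \<noteq> 0"
    using q(2) by (simp add: poly_eq_0_iff_dvd)
  then have "poly q' 1 \<noteq> 0"
    by (simp add: q'_def)
  then consider "0 < poly q' 1" | "poly q' 1 < 0" by linarith
  then show ?thesis
  proof cases
    case 1
    with p show ?thesis by (auto simp: nonneg_left_1_def)
  next
    case 2
    have "(poly q' \<longlongrightarrow> poly q' 1) (at_left 1)"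
      by (intro tendsto_poly tendsto_ident_at)
    then have "\<forall>\<^sub>F x in at_left 1. poly q' x < 0"
      using 2 by (rule order_tendstoD)
    moreover have "\<forall>\<^sub>F x in at_left (1::real). x < 1"
      by (simp add: eventually_at_filter)
    ultimately have "\<forall>\<^sub>F x in at_left 1. poly p x < 0"
      by eventually_elim (simp add: p poly_power mult_pos_neg)
    then show ?thesis ..
  qed
qed (simp add: nonneg_left_1_def)

text \<open>The cofactor multiplies the top coefficient by its positive value at 1, and every factor
  \<open>1 - X\<close> acts as a backward difference, which preserves the sign condition.\<close>

lemma lead_coeff_shift_act_nonneg:
  assumes "nonneg_left_1 p" "0 \<le> lead_coeff g"
  shows "0 \<le> lead_coeff (shift_act p g)"
proof (cases "p = 0")
  case False
  then obtain m q where p: "p = [:1, -1:] ^ m * q" and q: "0 < poly q 1"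
    using assms(1) by (auto simp: nonneg_left_1_def)
  have "0 \<le> lead_coeff (shift_act q g)"
  proof (cases "g = 0")
    case False
    then have "degree (shift_act q g) \<le> degree g"
      "0 < coeff (shift_act q g) (degree g)"
      using assms(2) q coeff_shift_act[of g "degree g" q] by (auto simp: order_less_le)
    then show ?thesis
      by (metis coeff_eq_0 le_neq_implies_less less_imp_le order_less_irrefl)
  qed simp
  then have "0 \<le> lead_coeff (shift_act ([:1, -1:] ^ n) (shift_act q g))" for n
  proof (induction n)
    case (Suc n)
    have "shift_act ([:1, -1:] ^ Suc n) (shift_act q g)
        = shift_act ([:1, -1:] ^ n) (shift_act q g)
          - pcompose (shift_act ([:1, -1:] ^ n) (shift_act q g)) [:-1, 1:]"
      by (simp only: power_Suc shift_act_mult) (simp add: pcompose_uminus)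
    then show ?case
      using lead_coeff_backward_difference_nonneg[OF Suc.IH[OF Suc.prems], of 1] by simp
  qed (simp add: one_pCons)
  then show ?thesis
    by (simp add: p shift_act_mult)
qed simp

section \<open>Blackwell optimal policies\<close>

text \<open>By pigeonhole two iterates agree on \<open>V\<close>, which gives a preperiod
  \<open>i\<close> and a period \<open>d\<close>; a positive multiple of \<open>d\<close> that is at
  least \<open>i\<close> serves as \<open>N\<close>.\<close>

lemma funpow_eventually_idempotent:
  assumes "finite V" "\<And>v. v \<in> V \<Longrightarrow> f v \<in> V"
  shows "\<exists>N>0. \<forall>v\<in>V. (f ^^ (N + N)) v = (f ^^ N) v"
proof -
  have closed: "(f ^^ n) v \<in> V" if "v \<in> V" for n v
    using that assms(2) by (induction n) auto
  define R where "R n = restrict (f ^^ n) V" for n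
  have "range R \<subseteq> V \<rightarrow>\<^sub>E V"
    using closed by (auto simp: R_def)
  moreover have "finite (V \<rightarrow>\<^sub>E V)"
    using assms(1) by (intro finite_PiE) auto
  ultimately have "\<not> inj R"
    using finite_subset infinite_UNIV_nat by (metis finite_imageD)
  then obtain i j where "i < j" and ij: "R i = R j"
    by (metis injI linorder_neqE_nat)
  define d where "d = j - i"
  have "0 < d" and j: "j = i + d"
    using \<open>i < j\<close> by (auto simp: d_def)
  have period: "(f ^^ (i + m * d)) v = (f ^^ i) v" if "v \<in> V" for m v
  proof (induction m)
    case (Suc m)
    have "i + Suc m * d = m * d + j" by (simp add: j)
    then have "(f ^^ (i + Suc m * d)) v = (f ^^ (m * d)) ((f ^^ j) v)"
      by (simp only: funpow_add o_def)
    also have "\<dots> = (f ^^ (m * d)) ((f ^^ i) v)"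
      using that ij by (metis R_def restrict_apply')
    also have "\<dots> = (f ^^ (m * d + i)) v"
      by (simp only: funpow_add o_def)
    also have "\<dots> = (f ^^ i) v"
      using Suc by (simp only: add.commute)
    finally show ?case .
  qed simp
  define N where "N = d * Suc i"
  have "i \<le> N"
    using \<open>0 < d\<close> mult_le_mono[of 1 d i "Suc i"] by (simp add: N_def)
  then obtain m where m: "N = m + i" by (metis le_add_diff_inverse2)
  have "(f ^^ (N + N)) v = (f ^^ N) v" if "v \<in> V" for v
  proof -
    have "N + N = m + (i + Suc i * d)"
      using m by (simp add: N_def mult.commute)
    then show ?thesis
      using period[OF that, of "Suc i"] m by (simp only: funpow_add o_def)
  qed
  with \<open>0 < d\<close> show ?thesis
    by (intro exI[of _ N]) (simp add: N_def)
qed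

section \<open>The one-player problem: discounted and finite-horizon values\<close>

locale finite_decisions =
  fixes V :: "'a set" and A :: "'a \<Rightarrow> 'b set" and nxt :: "'b \<Rightarrow> 'a" and r :: "'b \<Rightarrow> real"
  assumes finite_V: "finite V"
    and finite_A: "v \<in> V \<Longrightarrow> finite (A v)"
    and A_nonempty: "v \<in> V \<Longrightarrow> A v \<noteq> {}"
    and nxt_in_V: "v \<in> V \<Longrightarrow> e \<in> A v \<Longrightarrow> nxt e \<in> V"
begin

lemma finite_policies: "finite (PiE V A)"
  using finite_V finite_A by (rule finite_PiE)

lemma policies_nonempty: "PiE V A \<noteq> {}"
  using A_nonempty by (simp add: PiE_eq_empty_iff)

text \<open>
  The polynomial \<open>q v\<close> is \<open>1 - X ^ N\<close> times the discounted value of \<open>v\<close>, as a function of the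
  discount factor \<open>X\<close>.
\<close>

lemma policy_value_poly:
  assumes "s \<in> PiE V A"
  shows "\<exists>N>0. \<exists>q. \<forall>v\<in>V. q v - pCons 0 (q (nxt (s v))) = smult (r (s v)) (1 - monom 1 N)"
proof -
  define f where "f v = nxt (s v)" for v
  have "f v \<in> V" if "v \<in> V" for v
    using assms that nxt_in_V by (auto simp: f_def)
  then obtain N where N: "0 < N" "\<And>v. v \<in> V \<Longrightarrow> (f ^^ (N + N)) v = (f ^^ N) v"
    using funpow_eventually_idempotent[OF finite_V, of f] by blast
  define R where "R t v = r (s ((f ^^ t) v))" for t v
  define P where "P m v = (\<Sum>t<m. monom (R t v) t)" for m v
  \<comment> \<open>From time \<open>N\<close> on the rewards have period \<open>N\<close>, so the
    discounted value is \<open>P N + (P (N + N) - P N) / (1 - X ^ N)\<close>; multiplying by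
    \<open>1 - X ^ N\<close> gives \<open>q\<close>.\<close>
  define q where "q v = P (N + N) v - monom 1 N * P N v" for v
  have R_Suc: "R (Suc t) v = R t (f v)" for t v
    by (simp add: R_def funpow_swap1)
  have P_Suc: "P (Suc m) v = pCons (R 0 v) (P m (f v))" for m v
  proof (induction m)
    case (Suc m)
    have "P (Suc (Suc m)) v = P (Suc m) v + monom (R (Suc m) v) (Suc m)"
      by (simp add: P_def)
    also have "\<dots> = pCons (R 0 v) (P (Suc m) (f v))"
      by (simp add: Suc R_Suc monom_Suc) (simp add: P_def)
    finally show ?case .
  qed (simp add: P_def monom_0)
  have P_shift: "pCons 0 (P m (f v)) = P m v + monom (R m v) m - [:R 0 v:]" for m v
    using P_Suc[of m v] by (simp add: P_def algebra_simps)
  have "q v - pCons 0 (q (f v)) = smult (r (s v)) (1 - monom 1 N)" if "v \<in> V" for v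
  proof -
    have "pCons 0 (q (f v)) = pCons 0 (P (N + N) (f v)) - monom 1 N * pCons 0 (P N (f v))"
      by (simp add: q_def)
    \<comment> \<open>This makes the two boundary terms of degree \<open>N + N\<close>
      cancel.\<close>
    moreover have "R (N + N) v = R N v"
      using N(2)[OF that] by (simp add: R_def)
    moreover have "[:R 0 v:] = smult (r (s v)) 1"
      by (simp add: R_def)
    ultimately show ?thesis
      by (simp add: q_def P_shift smult_diff_right algebra_simps mult_monom smult_monom)
  qed
  with N(1) show ?thesis
    unfolding f_def by blast
qed

text \<open>Policy improvement: take a policy maximising the sum of the values over
  \<open>V\<close>. Switching to a profitable arc at one vertex would raise the value there and
  lower it nowhere.\<close>

lemma discounted_optimal_policy:
  assumes "0 \<le> \<beta>" "\<beta> < 1"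
    and x: "\<And>s v. s \<in> PiE V A \<Longrightarrow> v \<in> V \<Longrightarrow> x s v = r (s v) + \<beta> * x s (nxt (s v))"
  shows "\<exists>s\<in>PiE V A. \<forall>v\<in>V. \<forall>e\<in>A v. r e + \<beta> * x s (nxt e) \<le> x s v"
proof -
  obtain s where s: "s \<in> PiE V A"
    and s_max: "\<And>s'. s' \<in> PiE V A \<Longrightarrow> (\<Sum>v\<in>V. x s' v) \<le> (\<Sum>v\<in>V. x s v)"
    using arg_min_if_finite[OF finite_policies policies_nonempty, of "\<lambda>s. - (\<Sum>v\<in>V. x s v)"]
    by (metis neg_less_iff_less not_le)
  have "r e + \<beta> * x s (nxt e) \<le> x s v" if v: "v \<in> V" and e: "e \<in> A v" for v e
  proof (rule ccontr)
    assume "\<not> ?thesis"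
    then have gain: "x s v < r e + \<beta> * x s (nxt e)" by simp
    define s' where "s' = s(v := e)"
    have s': "s' \<in> PiE V A"
      using s v e by (auto simp: s'_def PiE_iff extensional_def)
    define D where "D u = x s' u - x s u" for u
    have D_v: "\<beta> * D (nxt e) < D v"
      using x[OF s' v] gain by (simp add: D_def s'_def algebra_simps)
    have D_step: "\<beta> * D (nxt (s' u)) \<le> D u" if "u \<in> V" for u
    proof (cases "u = v")
      case False
      then show ?thesis
        using x[OF s' that] x[OF s that] by (simp add: D_def s'_def algebra_simps)
    qed (use D_v in \<open>simp add: s'_def\<close>)
    \<comment> \<open>Minimum principle: a minimiser \<open>u\<close> satisfies
      \<open>D u \<ge> \<beta> * D u\<close>, which forces \<open>D u \<ge> 0\<close>.\<close>
    obtain u where u: "u \<in> V" "\<And>w. w \<in> V \<Longrightarrow> D u \<le> D w"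
      using arg_min_if_finite[OF finite_V, of D] v by (metis empty_iff not_le)
    have "nxt (s' u) \<in> V"
      using s' u(1) nxt_in_V by auto
    then have "\<beta> * D u \<le> \<beta> * D (nxt (s' u))"
      using u(2) assms(1) by (intro mult_left_mono) auto
    with D_step[OF u(1)] have "0 \<le> (1 - \<beta>) * D u"
      by (simp add: algebra_simps)
    with assms(2) have "0 \<le> D u"
      by (simp add: zero_le_mult_iff)
    with u(2) have D_nonneg: "0 \<le> D w" if "w \<in> V" for w
      using that by force
    have "0 \<le> \<beta> * D (nxt e)"
      using assms(1) D_nonneg nxt_in_V[OF v e] by simp
    with D_v have "0 < D v" by simp
    with D_nonneg v finite_V have "0 < (\<Sum>w\<in>V. D w)"
      by (intro sum_pos2) auto
    with s_max[OF s'] show False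
      by (simp add: D_def sum_subtractf)
  qed
  with s show ?thesis by blast
qed

text \<open>A policy violating the sign condition fails to be discount optimal on a whole left
  neighbourhood of 1. There are finitely many policies, so if all violated it, some discount factor
  would have no optimal policy.\<close>

lemma blackwell_optimal_policy:
  "\<exists>s\<in>PiE V A. \<exists>N>0. \<exists>q.
    (\<forall>v\<in>V. q v - pCons 0 (q (nxt (s v))) = smult (r (s v)) (1 - monom 1 N)) \<and>
    (\<forall>v\<in>V. \<forall>e\<in>A v. nonneg_left_1 (q v - pCons 0 (q (nxt e)) - smult (r e) (1 - monom 1 N)))"
proof -
  obtain N q where N: "\<And>s. s \<in> PiE V A \<Longrightarrow> 0 < N s"
    and q: "\<And>s v. s \<in> PiE V A \<Longrightarrow> v \<in> V \<Longrightarrow>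
      q s v - pCons 0 (q s (nxt (s v))) = smult (r (s v)) (1 - monom 1 (N s))"
    using policy_value_poly by metis
  define p where "p s v e = q s v - pCons 0 (q s (nxt e)) - smult (r e) (1 - monom 1 (N s))" for s v e
  have optimal: "\<exists>s\<in>PiE V A. \<forall>v\<in>V. \<forall>e\<in>A v. 0 \<le> poly (p s v e) \<beta>" if "0 < \<beta>" "\<beta> < 1" for \<beta>
  proof -
    define x where "x s v = poly (q s v) \<beta> / (1 - \<beta> ^ N s)" for s v
    have pos: "0 < 1 - \<beta> ^ N s" if "s \<in> PiE V A" for s
      using N[OF that] \<open>0 < \<beta>\<close> \<open>\<beta> < 1\<close> by (simp add: power_less_one_iff)
    have poly_q: "poly (q s v) \<beta> = x s v * (1 - \<beta> ^ N s)" if "s \<in> PiE V A" for s v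
      using pos[OF that] by (simp add: x_def)
    have poly_p: "poly (p s v e) \<beta> = (x s v - (r e + \<beta> * x s (nxt e))) * (1 - \<beta> ^ N s)"
      if "s \<in> PiE V A" for s v e
      by (simp add: p_def poly_q[OF that] poly_monom algebra_simps)
    have "x s v = r (s v) + \<beta> * x s (nxt (s v))" if "s \<in> PiE V A" "v \<in> V" for s v
      using poly_p[OF that(1), of v "s v"] pos[OF that(1)] q[OF that] by (simp add: p_def)
    from discounted_optimal_policy[of \<beta> x, OF _ \<open>\<beta> < 1\<close> this] \<open>0 < \<beta>\<close>
    obtain s where s: "s \<in> PiE V A" "\<forall>v\<in>V. \<forall>e\<in>A v. r e + \<beta> * x s (nxt e) \<le> x s v"
      by auto
    have "0 \<le> poly (p s v e) \<beta>" if "v \<in> V" "e \<in> A v" for v e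
      using s that pos[OF s(1)] by (simp add: poly_p)
    with s(1) show ?thesis by blast
  qed
  have "\<exists>s\<in>PiE V A. \<forall>v\<in>V. \<forall>e\<in>A v. nonneg_left_1 (p s v e)"
  proof (rule ccontr)
    assume "\<not> ?thesis"
    then have neg: "\<exists>v\<in>V. \<exists>e\<in>A v. \<forall>\<^sub>F \<beta> in at_left 1. poly (p s v e) \<beta> < 0" if "s \<in> PiE V A" for s
      using that nonneg_left_1_or_neg by blast
    have "\<forall>\<^sub>F \<beta> in at_left 1. \<exists>v\<in>V. \<exists>e\<in>A v. poly (p s v e) \<beta> < 0" if "s \<in> PiE V A" for s
    proof -
      from neg[OF that] obtain v e where "v \<in> V" "e \<in> A v"
        "\<forall>\<^sub>F \<beta> in at_left 1. poly (p s v e) \<beta> < 0"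
        by blast
      from this(3) show ?thesis
        by (rule eventually_mono) (use \<open>v \<in> V\<close> \<open>e \<in> A v\<close> in blast)
    qed
    then have "\<forall>\<^sub>F \<beta> in at_left 1. \<forall>s\<in>PiE V A. \<exists>v\<in>V. \<exists>e\<in>A v. poly (p s v e) \<beta> < 0"
      using finite_policies by (simp add: eventually_ball_finite)
    moreover have "\<forall>\<^sub>F \<beta> in at_left 1. 0 < \<beta> \<and> \<beta> < (1::real)"
      using eventually_at_left_real[of 0 1] by simp
    ultimately have "\<forall>\<^sub>F \<beta> in at_left (1::real). False"
      by eventually_elim (use optimal in \<open>meson not_le\<close>)
    then show False by simp
  qed
  then show ?thesis
    unfolding p_def using N q by blast
qed

text \<open>\<open>F n\<close> acts as a value function with \<open>n\<close> arcs to go. It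
  satisfies the optimality equation exactly along \<open>s\<close>, and as an inequality along other
  arcs up to errors whose total stays bounded, so the loss does not grow with the horizon.\<close>

lemma finite_horizon_values:
  fixes c :: "real poly"
  assumes "0 < lead_coeff c"
  obtains s :: "'a \<Rightarrow> 'b" and F :: "nat \<Rightarrow> 'a \<Rightarrow> real" and \<epsilon> :: "nat \<Rightarrow> real" and K :: real
  where "s \<in> PiE V A"
    and "\<And>n v e. v \<in> V \<Longrightarrow> e \<in> A v \<Longrightarrow> poly c (real n) * r e + F n (nxt e) \<le> F (Suc n) v + \<epsilon> n"
    and "\<And>n v. v \<in> V \<Longrightarrow> poly c (real n) * r (s v) + F n (nxt (s v)) = F (Suc n) v"
    and "\<And>n. (\<Sum>j<n. \<epsilon> j) \<le> K"
proof -
  obtain s N q where s: "s \<in> PiE V A" and "0 < N"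
    and tight: "\<And>v. v \<in> V \<Longrightarrow> q v - pCons 0 (q (nxt (s v))) = smult (r (s v)) (1 - monom 1 N)"
    and slack: "\<And>v e. v \<in> V \<Longrightarrow> e \<in> A v \<Longrightarrow>
      nonneg_left_1 (q v - pCons 0 (q (nxt e)) - smult (r e) (1 - monom 1 N))"
    using blackwell_optimal_policy by blast
  obtain g where "g - pcompose g [:- real N, 1:] = c"
    using backward_difference_eq_solvable[of "real N" c] \<open>0 < N\<close> by auto
  then have g: "shift_act (1 - monom 1 N) g = c"
    by (simp add: shift_act_diff shift_act_monom one_pCons)
  \<comment> \<open>A negative leading coefficient of \<open>g\<close> would, applied to
    \<open>- g\<close>, make that of \<open>- c\<close> nonnegative.\<close>
  have "0 \<le> lead_coeff g"
  proof (rule ccontr)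
    assume "\<not> 0 \<le> lead_coeff g"
    then have "0 \<le> lead_coeff (- g - pcompose (- g) [:- real N, 1:])"
      using \<open>0 < N\<close> by (intro lead_coeff_backward_difference_nonneg) auto
    also have "- g - pcompose (- g) [:- real N, 1:] = - c"
      using g by (simp add: shift_act_diff shift_act_monom pcompose_uminus one_pCons algebra_simps)
    finally show False using assms by simp
  qed
  \<comment> \<open>The offset aligns the indices: at the point \<open>n\<close>, \<open>q v\<close>
    gives \<open>F (Suc n) v\<close> and the shifted \<open>q w\<close> gives
    \<open>F n w\<close>.\<close>
  define F where "F n v = poly (shift_act (q v) g) (real n - 1)" for n v
  define gap where "gap v e = shift_act (q v - pCons 0 (q (nxt e)) - smult (r e) (1 - monom 1 N)) g" for v e
  have poly_gap: "poly (gap v e) (real n) = F (Suc n) v - F n (nxt e) - poly c (real n) * r e" for n v e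
    by (simp add: gap_def F_def shift_act_diff[of _ "smult _ _"] shift_act_diff[of _ "pCons _ _"]
        shift_act_smult g poly_pcompose)
  \<comment> \<open>Adding the negative parts over all arcs dominates each single gap and vanishes
    once every gap polynomial has become nonnegative.\<close>
  define \<epsilon> where "\<epsilon> n = (\<Sum>v\<in>V. \<Sum>e\<in>A v. max 0 (- poly (gap v e) (real n)))" for n
  have "\<forall>\<^sub>F n in sequentially. 0 \<le> poly (gap v e) (real n)" if "v \<in> V" "e \<in> A v" for v e
    using lead_coeff_shift_act_nonneg[OF slack[OF that] \<open>0 \<le> lead_coeff g\<close>]
    unfolding gap_def[symmetric] poly_eventually_nonneg_iff
    by (rule eventually_compose_filterlim[OF _ filterlim_real_sequentially])
  then have "\<forall>\<^sub>F n in sequentially. \<forall>v\<in>V. \<forall>e\<in>A v. 0 \<le> poly (gap v e) (real n)"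
    using finite_V finite_A by (simp add: eventually_ball_finite)
  then obtain n0 where n0: "\<And>n v e. n0 \<le> n \<Longrightarrow> v \<in> V \<Longrightarrow> e \<in> A v \<Longrightarrow> 0 \<le> poly (gap v e) (real n)"
    unfolding eventually_sequentially by blast
  show thesis
  proof (rule that[of s F \<epsilon> "\<Sum>j<n0. \<epsilon> j"])
    show "poly c (real n) * r e + F n (nxt e) \<le> F (Suc n) v + \<epsilon> n" if "v \<in> V" "e \<in> A v" for n v e
    proof -
      have "- poly (gap v e) (real n) \<le> max 0 (- poly (gap v e) (real n))" by simp
      also have "\<dots> \<le> (\<Sum>e\<in>A v. max 0 (- poly (gap v e) (real n)))"
        using that finite_A by (intro member_le_sum) auto
      also have "\<dots> \<le> \<epsilon> n"
        unfolding \<epsilon>_def using that finite_V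
        by (intro member_le_sum[where f = "\<lambda>v. \<Sum>e\<in>A v. max 0 (- poly (gap v e) (real n))"]) (auto intro: sum_nonneg)
      finally show ?thesis by (simp add: poly_gap)
    qed
    show "poly c (real n) * r (s v) + F n (nxt (s v)) = F (Suc n) v" if "v \<in> V" for n v
      using poly_gap[of v "s v" n] tight[OF that] by (simp add: gap_def)
    have \<epsilon>_nonneg: "0 \<le> \<epsilon> n" for n
      by (auto simp: \<epsilon>_def intro!: sum_nonneg)
    have \<epsilon>_0: "\<epsilon> n = 0" if "n0 \<le> n" for n
      using n0[OF that] by (simp add: \<epsilon>_def)
    show "(\<Sum>j<n. \<epsilon> j) \<le> (\<Sum>j<n0. \<epsilon> j)" for n
    proof -
      have "(\<Sum>j<n. \<epsilon> j) = (\<Sum>j\<in>{..<n} \<inter> {..<n0}. \<epsilon> j)"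
        by (intro sum.mono_neutral_right) (auto intro: \<epsilon>_0)
      also have "\<dots> \<le> (\<Sum>j<n0. \<epsilon> j)"
        using \<epsilon>_nonneg by (intro sum_mono2) auto
      finally show ?thesis .
    qed
  qed (fact s)
qed

end

section \<open>Iterated partial sums\<close>

text \<open>Pascal's rule, used in an inner induction on \<open>n\<close>. Starting from one
  summation keeps the lower index of the binomial a natural number.\<close>

lemma funpow_Suc_partial_sums:
  "(partial_sums ^^ Suc k) a n = (\<Sum>i\<le>n. real (n - i + k choose k) * a i)"
proof (induction k arbitrary: n)
  case 0
  show ?case by (simp add: partial_sums_def)
next
  case (Suc k)
  have "(partial_sums ^^ Suc (Suc k)) a n = (\<Sum>j\<le>n. (partial_sums ^^ Suc k) a j)" for n
    by (simp add: partial_sums_def)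
  then have eq: "(partial_sums ^^ Suc (Suc k)) a n
      = (\<Sum>j\<le>n. \<Sum>i\<le>j. real (j - i + k choose k) * a i)" for n
    by (simp only: Suc)
  have "(\<Sum>j\<le>n. \<Sum>i\<le>j. real (j - i + k choose k) * a i)
      = (\<Sum>i\<le>n. real (n - i + Suc k choose Suc k) * a i)"
  proof (induction n)
    case (Suc n)
    have "(\<Sum>i\<le>n. real (Suc n - i + Suc k choose Suc k) * a i)
        = (\<Sum>i\<le>n. real (n - i + Suc k choose Suc k) * a i + real (Suc n - i + k choose k) * a i)"
      by (intro sum.cong) (auto simp: Suc_diff_le algebra_simps)
    with Suc show ?case
      by (simp add: sum.distrib)
  qed simp
  with eq show ?case by simp
qed

text \<open>Summing once more gives entry \<open>T - 1\<close> of the \<open>(k + 1)\<close>-fold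
  partial sums.\<close>

lemma sum_funpow_partial_sums:
  "(\<Sum>t<T. (partial_sums ^^ k) a t) = (\<Sum>t<T. real (T - Suc t + k choose k) * a t)"
proof (cases T)
  case (Suc n)
  have "(\<Sum>t<T. (partial_sums ^^ k) a t) = (partial_sums ^^ Suc k) a n"
    by (simp add: Suc partial_sums_def lessThan_Suc_atMost)
  then show ?thesis
    unfolding funpow_Suc_partial_sums by (simp add: Suc lessThan_Suc_atMost)
qed simp

text \<open>The polynomial is the rising factorial \<open>(x + 1) ... (x + k)\<close> divided by
  \<open>k!\<close>.\<close>

lemma binomial_poly:
  "\<exists>c :: real poly. 0 < lead_coeff c \<and> (\<forall>n. poly c (real n) = real (n + k choose k))"
proof -
  define c :: "real poly" where "c = smult (1 / fact k) (\<Prod>i\<in>{0..<k}. [:1 + real i, 1:])"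
  have "lead_coeff (\<Prod>i\<in>{0..<k}. [:1 + real i, 1:]) = 1"
    by (simp add: lead_coeff_prod)
  then have "0 < lead_coeff c"
    by (simp add: c_def)
  moreover have "poly c (real n) = real (n + k choose k)" for n
    by (simp add: c_def poly_prod binomial_gbinomial gbinomial_pochhammer' pochhammer_prod add.commute add.left_commute)
  ultimately show ?thesis by blast
qed

text \<open>
  A bound up to a constant, uniform in the horizon, is what makes the comparison work for both
  players although the payoff is a lower limit.
\<close>

lemma total_reward_mono:
  assumes "\<And>T. (\<Sum>t<T. (partial_sums ^^ k) a t) \<le> (\<Sum>t<T. (partial_sums ^^ k) b t) + C"
  shows "total_reward k a \<le> total_reward k b"
proof -
  define x where "x = (\<lambda>T. ereal ((\<Sum>t<T. (partial_sums ^^ k) a t) / real T))"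
  define y where "y = (\<lambda>T. ereal ((\<Sum>t<T. (partial_sums ^^ k) b t) / real T))"
  have "x T \<le> ereal (C / real T) + y T" for T
    using divide_right_mono[OF assms[of T], of "real T"]
    by (simp add: x_def y_def add_divide_distrib add.commute)
  then have "liminf x \<le> liminf (\<lambda>T. ereal (C / real T) + y T)"
    by (intro Liminf_mono) simp
  also have "(\<lambda>T. C / real T) \<longlonglongrightarrow> 0"
    by (rule lim_const_over_n)
  then have "liminf (\<lambda>T. ereal (C / real T) + y T) = ereal 0 + liminf y"
    by (intro ereal_liminf_lim_add) auto
  finally show ?thesis
    by (simp add: total_reward_def lim_avg_def x_def y_def)
qed

section \<open>Random plays\<close>

lemma expected_rewards_uminus:
  "expected_rewards G B (\<lambda>e. - r e) v0 \<sigma>B \<sigma>W t = - expected_rewards G B r v0 \<sigma>B \<sigma>W t"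
  by (simp add: expected_rewards_def)

lemma current_snoc [simp]: "current G v0 (h @ [e]) = head G e"
  by (simp add: current_def)

lemma map_butlast_history_pmf:
  "map_pmf butlast (history_pmf G B v0 \<sigma>B \<sigma>W (Suc n)) = history_pmf G B v0 \<sigma>B \<sigma>W n"
  by (simp add: map_bind_pmf map_pmf_comp bind_return_pmf')

section \<open>Plays restricted to admissible arcs\<close>

context bw_game
begin

text \<open>With \<open>A\<close> a singleton at one player's positions this is the one-player
  problem; with \<open>{s v}\<close> everywhere it is the play of a stationary policy. The bounds
  below thus do not depend on who controls a position.\<close>

definition play_within :: "('a \<Rightarrow> 'b set) \<Rightarrow> 'b strategy \<Rightarrow> 'b strategy \<Rightarrow> bool" where
  "play_within A \<sigma>B \<sigma>W \<longleftrightarrow> (\<forall>v\<in>verts G. A v \<subseteq> out_arcs G v) \<and>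
     (\<forall>h. awalk v0 h (current G v0 h) \<longrightarrow>
       set_pmf (next_arc G B v0 \<sigma>B \<sigma>W h) \<subseteq> A (current G v0 h))"

lemma history_pmf_awalk:
  assumes "play_within A \<sigma>B \<sigma>W" "h \<in> set_pmf (history_pmf G B v0 \<sigma>B \<sigma>W n)"
  shows "awalk v0 h (current G v0 h)"
  using assms(2)
proof (induction n arbitrary: h)
  case 0
  then show ?case
    using initial by (simp add: current_def awalk_Nil_iff)
next
  case (Suc n)
  then obtain h' e where h: "h = h' @ [e]" and e: "e \<in> set_pmf (next_arc G B v0 \<sigma>B \<sigma>W h')"
    and h': "awalk v0 h' (current G v0 h')"
    by auto
  have "e \<in> out_arcs G (current G v0 h')"
    using assms(1) e h' awalk_last_in_verts[OF h'] unfolding play_within_def by blast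
  then have "awalk (current G v0 h') [e] (head G e)"
    using arc_implies_awalk by (metis in_out_arcs_conv)
  with h' h show ?case
    by (auto intro: awalk_appendI)
qed

lemma history_pmf_SucE:
  assumes "play_within A \<sigma>B \<sigma>W" "h \<in> set_pmf (history_pmf G B v0 \<sigma>B \<sigma>W (Suc n))"
  obtains h' e where "h = h' @ [e]" "h' \<in> set_pmf (history_pmf G B v0 \<sigma>B \<sigma>W n)"
    "current G v0 h' \<in> verts G" "e \<in> A (current G v0 h')"
proof -
  from assms(2) obtain h' e where h: "h = h' @ [e]"
    and h': "h' \<in> set_pmf (history_pmf G B v0 \<sigma>B \<sigma>W n)"
    and e: "e \<in> set_pmf (next_arc G B v0 \<sigma>B \<sigma>W h')"
    by auto
  have "awalk v0 h' (current G v0 h')"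
    using history_pmf_awalk[OF assms(1) h'] .
  with assms(1) e have "e \<in> A (current G v0 h')" "current G v0 h' \<in> verts G"
    using awalk_last_in_verts by (auto simp: play_within_def)
  with that h h' show thesis by blast
qed

lemma finite_set_history_pmf:
  assumes "play_within A \<sigma>B \<sigma>W"
  shows "finite (set_pmf (history_pmf G B v0 \<sigma>B \<sigma>W n))"
proof (induction n)
  case (Suc n)
  have "set_pmf (history_pmf G B v0 \<sigma>B \<sigma>W (Suc n))
      \<subseteq> (\<lambda>(h, e). h @ [e]) ` (set_pmf (history_pmf G B v0 \<sigma>B \<sigma>W n) \<times> arcs G)"
  proof
    fix h assume "h \<in> set_pmf (history_pmf G B v0 \<sigma>B \<sigma>W (Suc n))"
    from history_pmf_SucE[OF assms this] obtain h' e where *: "h = h' @ [e]"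
      "h' \<in> set_pmf (history_pmf G B v0 \<sigma>B \<sigma>W n)"
      "current G v0 h' \<in> verts G" "e \<in> A (current G v0 h')" .
    then have "e \<in> arcs G"
      using assms unfolding play_within_def by (meson in_out_arcs_conv subsetD)
    with * show "h \<in> (\<lambda>(h, e). h @ [e]) ` (set_pmf (history_pmf G B v0 \<sigma>B \<sigma>W n) \<times> arcs G)"
      by force
  qed
  then show ?case
    using Suc finite_arcs by (meson finite_SigmaI finite_imageI finite_subset)
qed simp

text \<open>The arcwise inequality is averaged over histories of length \<open>t + 1\<close>, with
  \<open>g\<close> read off at the tail of the last arc; dropping that arc returns the law of the
  shorter history.\<close>

lemma expected_step_le:
  assumes play: "play_within A \<sigma>B \<sigma>W"
    and le: "\<And>v e. v \<in> verts G \<Longrightarrow> e \<in> A v \<Longrightarrow> c * r e + f (head G e) \<le> g v + d"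
  shows "c * expected_rewards G B r v0 \<sigma>B \<sigma>W t
      + measure_pmf.expectation (history_pmf G B v0 \<sigma>B \<sigma>W (Suc t)) (\<lambda>h. f (current G v0 h))
    \<le> measure_pmf.expectation (history_pmf G B v0 \<sigma>B \<sigma>W t) (\<lambda>h. g (current G v0 h)) + d"
proof -
  let ?H = "history_pmf G B v0 \<sigma>B \<sigma>W"
  let ?H' = "?H (Suc t)"
  have int: "integrable (measure_pmf ?H') \<phi>" for \<phi> :: "'b list \<Rightarrow> real"
    using finite_set_history_pmf[OF play] by (rule integrable_measure_pmf_finite)
  have "c * expected_rewards G B r v0 \<sigma>B \<sigma>W t
      + measure_pmf.expectation ?H' (\<lambda>h. f (current G v0 h))
    = measure_pmf.expectation ?H' (\<lambda>h. c * r (last h) + f (current G v0 h))"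
    unfolding expected_rewards_def by (simp add: int del: history_pmf.simps)
  also have "\<dots> \<le> measure_pmf.expectation ?H' (\<lambda>h. g (current G v0 (butlast h)) + d)"
  proof (intro integral_mono_AE int AE_pmfI)
    fix h assume "h \<in> set_pmf ?H'"
    from history_pmf_SucE[OF play this] obtain h' e where "h = h' @ [e]"
      "current G v0 h' \<in> verts G" "e \<in> A (current G v0 h')"
      by metis
    then show "c * r (last h) + f (current G v0 h) \<le> g (current G v0 (butlast h)) + d"
      using le by simp
  qed
  also have "\<dots> = measure_pmf.expectation ?H' (\<lambda>h. g (current G v0 (butlast h))) + d"
    by (simp add: int del: history_pmf.simps)
  also have "measure_pmf.expectation ?H' (\<lambda>h. g (current G v0 (butlast h)))
    = measure_pmf.expectation (?H t) (\<lambda>h. g (current G v0 h))"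
    unfolding map_butlast_history_pmf[of G B v0 \<sigma>B \<sigma>W t, symmetric]
    by (simp del: history_pmf.simps)
  finally show ?thesis .
qed

text \<open>Telescoping: arc number \<open>t\<close>, counted from 0, is followed by
  \<open>T - Suc t\<close> further arcs, so the inequality is used with
  \<open>n = T - Suc t\<close>.\<close>

lemma weighted_rewards_le:
  fixes c :: "nat \<Rightarrow> real" and F :: "nat \<Rightarrow> 'a \<Rightarrow> real"
  assumes play: "play_within A \<sigma>B \<sigma>W"
    and le: "\<And>n v e. v \<in> verts G \<Longrightarrow> e \<in> A v \<Longrightarrow> c n * r e + F n (head G e) \<le> F (Suc n) v + \<epsilon> n"
  shows "(\<Sum>t<T. c (T - Suc t) * expected_rewards G B r v0 \<sigma>B \<sigma>W t)
    \<le> F T v0 + (\<Sum>j<T. \<epsilon> j) + (\<Sum>v\<in>verts G. \<bar>F 0 v\<bar>)"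
proof -
  let ?H = "history_pmf G B v0 \<sigma>B \<sigma>W"
  let ?a = "expected_rewards G B r v0 \<sigma>B \<sigma>W"
  let ?E = "\<lambda>m n. measure_pmf.expectation (?H m) (\<lambda>h. F n (current G v0 h))"
  have partial: "(\<Sum>t<m. c (T - Suc t) * ?a t) + ?E m (T - m) \<le> F T v0 + (\<Sum>t<m. \<epsilon> (T - Suc t))"
    if "m \<le> T" for m
    using that
  proof (induction m)
    case (Suc m)
    have "c (T - Suc m) * ?a m + ?E (Suc m) (T - Suc m)
        \<le> ?E m (Suc (T - Suc m)) + \<epsilon> (T - Suc m)"
      by (rule expected_step_le[OF play]) (rule le)
    moreover have "Suc (T - Suc m) = T - m"
      using Suc.prems by simp
    ultimately show ?case
      using Suc by (simp del: history_pmf.simps)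
  qed (simp add: current_def)
  \<comment> \<open>The leftover term at the horizon has a lower bound independent of
    \<open>T\<close> and of the strategies.\<close>
  have "- (\<Sum>v\<in>verts G. \<bar>F 0 v\<bar>) \<le> ?E T 0"
  proof -
    have "measure_pmf.expectation (?H T) (\<lambda>h. - (\<Sum>v\<in>verts G. \<bar>F 0 v\<bar>)) \<le> ?E T 0"
    proof (intro integral_mono_AE AE_pmfI)
      fix h assume "h \<in> set_pmf (?H T)"
      then have "current G v0 h \<in> verts G"
        using history_pmf_awalk[OF play] awalk_last_in_verts by blast
      then have "\<bar>F 0 (current G v0 h)\<bar> \<le> (\<Sum>v\<in>verts G. \<bar>F 0 v\<bar>)"
        using finite_verts by (intro member_le_sum) auto
      then show "- (\<Sum>v\<in>verts G. \<bar>F 0 v\<bar>) \<le> F 0 (current G v0 h)" by linarith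
    qed (auto intro: integrable_measure_pmf_finite finite_set_history_pmf[OF play])
    then show ?thesis by simp
  qed
  moreover have "(\<Sum>t<T. \<epsilon> (T - Suc t)) = (\<Sum>j<T. \<epsilon> j)"
    by (rule sum.nat_diff_reindex)
  ultimately show ?thesis
    using partial[of T] by simp
qed

text \<open>Both sums are compared with \<open>F T v0\<close>. The quantifier order matters:
  \<open>C\<close> is chosen before the strategies and the horizon \<open>T\<close>.\<close>

lemma stationary_dominates:
  fixes r :: "'b \<Rightarrow> real" and k :: nat
  assumes A: "\<And>v. v \<in> verts G \<Longrightarrow> A v \<subseteq> out_arcs G v" "\<And>v. v \<in> verts G \<Longrightarrow> A v \<noteq> {}"
  obtains s C where "\<And>v. v \<in> verts G \<Longrightarrow> s v \<in> A v"
    and "\<And>\<sigma>B \<sigma>W \<tau>B \<tau>W T. play_within A \<sigma>B \<sigma>W \<Longrightarrow> play_within (\<lambda>v. {s v}) \<tau>B \<tau>W \<Longrightarrow>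
      (\<Sum>t<T. (partial_sums ^^ k) (expected_rewards G B r v0 \<sigma>B \<sigma>W) t)
        \<le> (\<Sum>t<T. (partial_sums ^^ k) (expected_rewards G B r v0 \<tau>B \<tau>W) t) + C"
proof -
  have "finite_decisions (verts G) A (head G)"
  proof
    show "finite (A v)" if "v \<in> verts G" for v
      using A(1)[OF that] by (rule finite_subset) (simp add: out_arcs_def)
    show "head G e \<in> verts G" if "v \<in> verts G" "e \<in> A v" for v e
      using A(1)[OF that(1)] that(2) by auto
  qed (use A(2) in simp_all)
  then interpret finite_decisions "verts G" A "head G" r .
  obtain c :: "real poly" where "0 < lead_coeff c"
    and c: "\<And>n. poly c (real n) = real (n + k choose k)"
    using binomial_poly by blast
  from finite_horizon_values[OF this(1)] obtain s F \<epsilon> K where s: "s \<in> PiE (verts G) A"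
    and F_le: "\<And>n v e. v \<in> verts G \<Longrightarrow> e \<in> A v \<Longrightarrow>
      poly c (real n) * r e + F n (head G e) \<le> F (Suc n) v + \<epsilon> n"
    and F_eq: "\<And>n v. v \<in> verts G \<Longrightarrow>
      poly c (real n) * r (s v) + F n (head G (s v)) = F (Suc n) v"
    and K: "\<And>n. (\<Sum>j<n. \<epsilon> j) \<le> K"
    by metis
  show thesis
  proof (rule that[of s "K + 2 * (\<Sum>v\<in>verts G. \<bar>F 0 v\<bar>)"])
    fix \<sigma>B \<sigma>W \<tau>B \<tau>W T
    assume \<sigma>: "play_within A \<sigma>B \<sigma>W" and \<tau>: "play_within (\<lambda>v. {s v}) \<tau>B \<tau>W"
    have upper: "(\<Sum>t<T. poly c (real (T - Suc t)) * expected_rewards G B r v0 \<sigma>B \<sigma>W t)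
        \<le> F T v0 + (\<Sum>j<T. \<epsilon> j) + (\<Sum>v\<in>verts G. \<bar>F 0 v\<bar>)"
      by (rule weighted_rewards_le[OF \<sigma>]) (rule F_le)
    \<comment> \<open>Along \<open>s\<close> the equation for \<open>F\<close> is exact, so the
      upper bound also applies to \<open>- r\<close> and \<open>- F\<close> with zero error, giving
      a lower bound for \<open>r\<close>.\<close>
    have "(\<Sum>t<T. poly c (real (T - Suc t)) * expected_rewards G B (\<lambda>e. - r e) v0 \<tau>B \<tau>W t)
        \<le> - F T v0 + (\<Sum>j<T. 0) + (\<Sum>v\<in>verts G. \<bar>- F 0 v\<bar>)"
    proof (rule weighted_rewards_le[OF \<tau>, of "\<lambda>n. poly c (real n)" "\<lambda>e. - r e" "\<lambda>n v. - F n v"])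
      show "poly c (real n) * - r e + - F n (head G e) \<le> - F (Suc n) v + 0"
        if "v \<in> verts G" "e \<in> {s v}" for n v e
        using F_eq[OF that(1), of n] that(2) by simp
    qed
    then have lower: "F T v0 - (\<Sum>v\<in>verts G. \<bar>F 0 v\<bar>)
        \<le> (\<Sum>t<T. poly c (real (T - Suc t)) * expected_rewards G B r v0 \<tau>B \<tau>W t)"
      by (simp add: expected_rewards_uminus sum_negf)
    show "(\<Sum>t<T. (partial_sums ^^ k) (expected_rewards G B r v0 \<sigma>B \<sigma>W) t)
        \<le> (\<Sum>t<T. (partial_sums ^^ k) (expected_rewards G B r v0 \<tau>B \<tau>W) t)
          + (K + 2 * (\<Sum>v\<in>verts G. \<bar>F 0 v\<bar>))"
      using upper lower K[of T] unfolding sum_funpow_partial_sums c[symmetric] by linarith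
  qed (use s in auto)
qed

lemma stationary_best_response:
  fixes r :: "'b \<Rightarrow> real" and k :: nat
  assumes A: "\<And>v. v \<in> verts G \<Longrightarrow> A v \<subseteq> out_arcs G v" "\<And>v. v \<in> verts G \<Longrightarrow> A v \<noteq> {}"
  shows "\<exists>s. (\<forall>v\<in>verts G. s v \<in> A v) \<and> (\<forall>\<sigma>B \<sigma>W \<tau>B \<tau>W.
      play_within A \<sigma>B \<sigma>W \<longrightarrow> play_within (\<lambda>v. {s v}) \<tau>B \<tau>W \<longrightarrow>
      payoff k G B r v0 \<sigma>B \<sigma>W \<le> payoff k G B r v0 \<tau>B \<tau>W)"
    and "\<exists>s. (\<forall>v\<in>verts G. s v \<in> A v) \<and> (\<forall>\<sigma>B \<sigma>W \<tau>B \<tau>W.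
      play_within A \<sigma>B \<sigma>W \<longrightarrow> play_within (\<lambda>v. {s v}) \<tau>B \<tau>W \<longrightarrow>
      payoff k G B r v0 \<tau>B \<tau>W \<le> payoff k G B r v0 \<sigma>B \<sigma>W)"
proof -
  show "\<exists>s. (\<forall>v\<in>verts G. s v \<in> A v) \<and> (\<forall>\<sigma>B \<sigma>W \<tau>B \<tau>W.
      play_within A \<sigma>B \<sigma>W \<longrightarrow> play_within (\<lambda>v. {s v}) \<tau>B \<tau>W \<longrightarrow>
      payoff k G B r v0 \<sigma>B \<sigma>W \<le> payoff k G B r v0 \<tau>B \<tau>W)"
    using stationary_dominates[OF A, where r = r and k = k] total_reward_mono
    unfolding payoff_def by metis
  \<comment> \<open>Negating payoffs would turn the lower limit into an upper one, so for the
    minimiser rewards are negated in the finite sums, before the limit is taken.\<close>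
  obtain s C where s: "\<And>v. v \<in> verts G \<Longrightarrow> s v \<in> A v"
    and dom: "\<And>\<sigma>B \<sigma>W \<tau>B \<tau>W T. play_within A \<sigma>B \<sigma>W \<Longrightarrow> play_within (\<lambda>v. {s v}) \<tau>B \<tau>W \<Longrightarrow>
      (\<Sum>t<T. (partial_sums ^^ k) (expected_rewards G B (\<lambda>e. - r e) v0 \<sigma>B \<sigma>W) t)
        \<le> (\<Sum>t<T. (partial_sums ^^ k) (expected_rewards G B (\<lambda>e. - r e) v0 \<tau>B \<tau>W) t) + C"
    using stationary_dominates[OF A, where r = "\<lambda>e. - r e" and k = k] by blast
  have "payoff k G B r v0 \<tau>B \<tau>W \<le> payoff k G B r v0 \<sigma>B \<sigma>W"
    if "play_within A \<sigma>B \<sigma>W" "play_within (\<lambda>v. {s v}) \<tau>B \<tau>W" for \<sigma>B \<sigma>W \<tau>B \<tau>W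
    unfolding payoff_def
  proof (rule total_reward_mono)
    show "(\<Sum>t<T. (partial_sums ^^ k) (expected_rewards G B r v0 \<tau>B \<tau>W) t)
        \<le> (\<Sum>t<T. (partial_sums ^^ k) (expected_rewards G B r v0 \<sigma>B \<sigma>W) t) + C" for T
      using dom[OF that, of T]
      by (simp add: sum_funpow_partial_sums expected_rewards_uminus sum_negf)
  qed
  with s show "\<exists>s. (\<forall>v\<in>verts G. s v \<in> A v) \<and> (\<forall>\<sigma>B \<sigma>W \<tau>B \<tau>W.
      play_within A \<sigma>B \<sigma>W \<longrightarrow> play_within (\<lambda>v. {s v}) \<tau>B \<tau>W \<longrightarrow>
      payoff k G B r v0 \<tau>B \<tau>W \<le> payoff k G B r v0 \<sigma>B \<sigma>W)"
    by blast
qed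

lemma set_pmf_next_arc_strategy:
  assumes "\<sigma> \<in> strategies G S v0" "awalk v0 h (current G v0 h)" "current G v0 h \<in> S"
  shows "set_pmf (\<sigma> h) \<subseteq> out_arcs G (current G v0 h)"
  using assms by (auto simp: strategies_def)

end

theorem theorem2:
  fixes G :: "('a, 'b) pre_digraph" and B W :: "'a set" and v0 :: 'a
    and r :: "'b \<Rightarrow> real" and k :: nat
  assumes "bw_game G B W v0"
  shows "(\<forall>sB \<in> pure_stationary G B. \<exists>sW \<in> pure_stationary G W. \<forall>\<sigma>W \<in> strategies G W v0.
            payoff k G B r v0 (stationary_strategy G v0 sB) \<sigma>W
              \<le> payoff k G B r v0 (stationary_strategy G v0 sB) (stationary_strategy G v0 sW))
       \<and> (\<forall>sW \<in> pure_stationary G W. \<exists>sB \<in> pure_stationary G B. \<forall>\<sigma>B \<in> strategies G B v0.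
            payoff k G B r v0 (stationary_strategy G v0 sB) (stationary_strategy G v0 sW)
              \<le> payoff k G B r v0 \<sigma>B (stationary_strategy G v0 sW))"
proof -
  interpret bw_game G B W v0 by fact
  have cur: "current G v0 h \<in> B \<union> W" if "awalk v0 h (current G v0 h)" for h
    using awalk_last_in_verts[OF that] positions by simp
  show ?thesis
  proof (intro conjI ballI)
    fix sB assume sB: "sB \<in> pure_stationary G B"
    \<comment> \<open>The fixed strategy of Min is absorbed into the arc sets, leaving Max as the
      sole decision maker.\<close>
    define A where "A v = (if v \<in> B then {sB v} else out_arcs G v)" for v
    have A: "A v \<subseteq> out_arcs G v" "A v \<noteq> {}" if "v \<in> verts G" for v
      using that sB no_sinks by (auto simp: A_def pure_stationary_def)
    obtain s where s: "\<And>v. v \<in> verts G \<Longrightarrow> s v \<in> A v"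
      and best: "\<And>\<sigma>B \<sigma>W \<tau>B \<tau>W. play_within A \<sigma>B \<sigma>W \<Longrightarrow> play_within (\<lambda>v. {s v}) \<tau>B \<tau>W \<Longrightarrow>
        payoff k G B r v0 \<sigma>B \<sigma>W \<le> payoff k G B r v0 \<tau>B \<tau>W"
      using stationary_best_response(1)[OF A, where r = r and k = k] by blast
    have "s \<in> pure_stationary G W"
      using s A(1) positions by (fastforce simp: pure_stationary_def)
    moreover have "play_within A (stationary_strategy G v0 sB) \<sigma>W" if "\<sigma>W \<in> strategies G W v0" for \<sigma>W
      unfolding play_within_def
    proof (intro conjI ballI allI impI)
      fix h assume "awalk v0 h (current G v0 h)"
      then show "set_pmf (next_arc G B v0 (stationary_strategy G v0 sB) \<sigma>W h) \<subseteq> A (current G v0 h)"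
        using cur[of h] set_pmf_next_arc_strategy[OF that, of h]
        by (auto simp del: in_out_arcs_conv simp add: next_arc_def stationary_strategy_def A_def)
    qed (rule A(1))
    \<comment> \<open>On \<open>B\<close> the set \<open>A v\<close> is a singleton, so
      \<open>s\<close> agrees with \<open>sB\<close> there and the pair plays the single policy
      \<open>s\<close>.\<close>
    moreover have "play_within (\<lambda>v. {s v}) (stationary_strategy G v0 sB) (stationary_strategy G v0 s)"
      unfolding play_within_def
    proof (intro conjI ballI allI impI)
      show "{s v} \<subseteq> out_arcs G v" if "v \<in> verts G" for v
        using s[OF that] A(1)[OF that] by blast
      fix h assume "awalk v0 h (current G v0 h)"
      then have "s (current G v0 h) \<in> A (current G v0 h)"
        by (intro s awalk_last_in_verts)
      then show "set_pmf (next_arc G B v0 (stationary_strategy G v0 sB) (stationary_strategy G v0 s) h)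
          \<subseteq> {s (current G v0 h)}"
        by (simp add: next_arc_def stationary_strategy_def A_def split: if_splits)
    qed
    ultimately show "\<exists>sW \<in> pure_stationary G W. \<forall>\<sigma>W \<in> strategies G W v0.
        payoff k G B r v0 (stationary_strategy G v0 sB) \<sigma>W
          \<le> payoff k G B r v0 (stationary_strategy G v0 sB) (stationary_strategy G v0 sW)"
      using best by blast
  next
    fix sW assume sW: "sW \<in> pure_stationary G W"
    define A where "A v = (if v \<in> B then out_arcs G v else {sW v})" for v
    have A: "A v \<subseteq> out_arcs G v" "A v \<noteq> {}" if "v \<in> verts G" for v
      using that sW no_sinks positions by (auto simp: A_def pure_stationary_def)
    obtain s where s: "\<And>v. v \<in> verts G \<Longrightarrow> s v \<in> A v"
      and best: "\<And>\<sigma>B \<sigma>W \<tau>B \<tau>W. play_within A \<sigma>B \<sigma>W \<Longrightarrow> play_within (\<lambda>v. {s v}) \<tau>B \<tau>W \<Longrightarrow>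
        payoff k G B r v0 \<tau>B \<tau>W \<le> payoff k G B r v0 \<sigma>B \<sigma>W"
      using stationary_best_response(2)[OF A, where r = r and k = k] by blast
    have "s \<in> pure_stationary G B"
      using s A(1) positions by (fastforce simp: pure_stationary_def)
    moreover have "play_within A \<sigma>B (stationary_strategy G v0 sW)" if "\<sigma>B \<in> strategies G B v0" for \<sigma>B
      unfolding play_within_def
    proof (intro conjI ballI allI impI)
      fix h assume "awalk v0 h (current G v0 h)"
      then show "set_pmf (next_arc G B v0 \<sigma>B (stationary_strategy G v0 sW) h) \<subseteq> A (current G v0 h)"
        using set_pmf_next_arc_strategy[OF that, of h]
        by (simp add: next_arc_def stationary_strategy_def A_def)
    qed (rule A(1))
    moreover have "play_within (\<lambda>v. {s v}) (stationary_strategy G v0 s) (stationary_strategy G v0 sW)"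
      unfolding play_within_def
    proof (intro conjI ballI allI impI)
      show "{s v} \<subseteq> out_arcs G v" if "v \<in> verts G" for v
        using s[OF that] A(1)[OF that] by blast
      fix h assume "awalk v0 h (current G v0 h)"
      then have "s (current G v0 h) \<in> A (current G v0 h)"
        by (intro s awalk_last_in_verts)
      then show "set_pmf (next_arc G B v0 (stationary_strategy G v0 s) (stationary_strategy G v0 sW) h)
          \<subseteq> {s (current G v0 h)}"
        by (simp add: next_arc_def stationary_strategy_def A_def split: if_splits)
    qed
    ultimately show "\<exists>sB \<in> pure_stationary G B. \<forall>\<sigma>B \<in> strategies G B v0.
        payoff k G B r v0 (stationary_strategy G v0 sB) (stationary_strategy G v0 sW)
          \<le> payoff k G B r v0 \<sigma>B (stationary_strategy G v0 sW)"
      using best by blast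
  qed
qed

end
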